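(* Consider an input sample whose correct class is $c$, one of $C$ classes, and let $\beta_1<\beta_2$ be two thresholds. Let $v_1,\dots,v_K$ be the softmax outputs of $K$ random dropout instances of a neural network on this input. Let the simple ensemble average algorithm (Algorithm 1) and the ensemble average with error correction algorithm (Algorithm 2), and the quantities $\alpha$, $\bar v_c^{\mathcal R,\beta_2^+}$, $\bar v_c^{\mathcal R,\beta_1^-}$, $\bar v_c^{\mathcal W,\beta_2^+}$, $\bar v_c^{\mathcal W,\beta_1^-}$, $F_c^{\mathcal R}$, $F_m^{\mathcal W}$, be as defined in the context. Suppose that the classes other than $c$ have equal probability mass with Algorithm 2. When $K\to\infty$, if $$\alpha\Big((1-\bar v_c^{\mathcal R,\beta_2^+})(1-F_c^{\mathcal R}(\beta_2))-(\bar v_c^{\mathcal R,\beta_1^-}-\tfrac1C)F_c^{\mathcal R}(\beta_1)\Big)>(1-\alpha)\Big(\bar v_c^{\mathcal W,\beta_2^+}(1-F_m^{\mathcal W}(\beta_2))-(\tfrac1C-\bar v_c^{\mathcal W,\beta_1^-})F_m^{\mathcal W}(\beta_1)\Big),$$ then Algorithm 2 provides a more accurate probability distribution for the correct category than Algorithm 1. That is, the probability mass of the correct class $c$ is larger with Algorithm 2 than with Algorithm 1 ($\Delta_c=p_2-p_1>0$), and any incorrect class has a reduced probability mass.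
   Context: Setting: a neural network classifier with $C$ classes, indexed $0,\dots,C-1$, is run with random dropout at test time on a fixed input belonging to class $c$. Each instance $k=1,\dots,K$ of dropout gives a deterministic network whose softmax output is a probability vector $v_k=(v_{k,0},\dots,v_{k,C-1})$. The ideal distribution for this input is the vector with mass $1$ at $c$ and $0$ at the other classes. Error correction: the corrected vector $\hat v_k$ is - the vector with entry $1$ at position $\operatorname{argmax}_i v_{k,i}$ and $0$ elsewhere, if $\max_i v_{k,i}\ge\beta_2$; - $v_k$, if $\beta_1\le\max_i v_{k,i}<\beta_2$; - $(1/C,\dots,1/C)$, if $\max_i v_{k,i}<\beta_1$. Algorithms: Algorithm 1 forms the element-wise average $s=\frac1K\sum_{k=1}^K v_k$. Algorithm 2 forms the element-wise average $s=\frac1K\sum_{k=1}^K\hat v_k$. (Each algorithm then declares the input "unknown or random" if $\max_i s_i$ is below a threshold $\lambda$, and otherwise returns the class $\operatorname{argmax}_i s_i$; the statement concerns only the distributions $s$.) Let $p_1$ and $p_2$ be the mass of class $c$ in $s$ under Algorithm 1 and Algorithm 2 respectively, and $\Delta_c=p_2-p_1$. Right and wrong instances: $\mathcal R=\{k : v_{k,c}>v_{k,i}\ \forall i\ne c\}$ is the set of instances making a right prediction, and $\mathcal W$ is its complement. $\alpha$ is the probability that an instance of the network makes a correct prediction. Conditional expectations of $v_{k,c}$: - $\bar v_c^{\mathcal R,\beta_2^+}$: conditioned on $k\in\mathcal R$ and $v_{k,c}>\beta_2$; - $\bar v_c^{\mathcal R,\beta_1^-}$: conditioned on $k\in\mathcal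 R$ and $v_{k,c}<\beta_1$; - $\bar v_c^{\mathcal W,\beta_2^+}$: conditioned on $k\in\mathcal W$ and $\max_i v_{k,i}>\beta_2$; - $\bar v_c^{\mathcal W,\beta_1^-}$: conditioned on $k\in\mathcal W$ and $\max_i v_{k,i}<\beta_1$. Conditional distribution functions: $F_c^{\mathcal R}(\beta)=\mathrm{Prob}[v_{k,c}\le\beta\mid k\in\mathcal R]$ and $F_m^{\mathcal W}(\beta)=\mathrm{Prob}[\max_i v_{k,i}\le\beta\mid k\in\mathcal W]$.
   Formalization: Adds continuity of F_c^R at β1 and of F_m^W at β1, β2; an incorrect class's reduced mass is proved against the average incorrect mass under Algorithm 1, and class by class only if those masses are equal under Algorithm 1 too (the literal claims fail). *)

theory Defs
  imports "HOL-Probability.Probability"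
begin

text \<open>
  Classes are the elements of a finite type \<open>'n\<close>, so \<open>C = CARD('n)\<close> and softmax outputs are
  vectors in \<open>real ^ 'n\<close>.
\<close>

definition prob_vector :: "real ^ 'n \<Rightarrow> bool" where
  "prob_vector x \<longleftrightarrow> (\<forall>i. 0 \<le> x $ i) \<and> (\<Sum>i\<in>UNIV. x $ i) = 1"

definition vmax :: "real ^ 'n \<Rightarrow> real" where
  "vmax x = (MAX i. x $ i)"

text \<open>If several classes attain the maximum, \<open>ARG_MAX\<close> selects one of them, arbitrarily but fixed.\<close>

definition error_correct :: "real \<Rightarrow> real \<Rightarrow> real ^ 'n \<Rightarrow> real ^ 'n" where
  "error_correct \<beta>\<^sub>1 \<beta>\<^sub>2 x =
     (if vmax x \<ge> \<beta>\<^sub>2 then axis (ARG_MAX (\<lambda>i. x $ i) i. True) 1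
      else if vmax x \<ge> \<beta>\<^sub>1 then x
      else (\<chi> i. 1 / real CARD('n)))"

text \<open>
  The distributions \<open>s\<close> formed by the two algorithms from the first \<open>K\<close> instances,
  which are numbered from \<open>0\<close>.
\<close>

definition algorithm1 :: "(nat \<Rightarrow> real ^ 'n) \<Rightarrow> nat \<Rightarrow> real ^ 'n" where
  "algorithm1 x K = (1 / real K) *\<^sub>R (\<Sum>k<K. x k)"

definition algorithm2 :: "real \<Rightarrow> real \<Rightarrow> (nat \<Rightarrow> real ^ 'n) \<Rightarrow> nat \<Rightarrow> real ^ 'n" where
  "algorithm2 \<beta>\<^sub>1 \<beta>\<^sub>2 x K = (1 / real K) *\<^sub>R (\<Sum>k<K. error_correct \<beta>\<^sub>1 \<beta>\<^sub>2 (x k))"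

definition right_prediction :: "'n \<Rightarrow> real ^ 'n \<Rightarrow> bool" where
  "right_prediction c x \<longleftrightarrow> (\<forall>i. i \<noteq> c \<longrightarrow> x $ c > x $ i)"

text \<open>
  The remaining quantities depend only on the common law \<open>D\<close> of the softmax output of one
  random instance. Conditional means and probabilities given a null event are \<open>0\<close>.
\<close>

definition cond_mean :: "'b measure \<Rightarrow> ('b \<Rightarrow> real) \<Rightarrow> ('b \<Rightarrow> bool) \<Rightarrow> real" where
  "cond_mean D f P =
     (LINT x:{x \<in> space D. P x}|D. f x) / measure D {x \<in> space D. P x}"

definition alpha :: "(real ^ 'n) measure \<Rightarrow> 'n \<Rightarrow> real" where
  "alpha D c = measure D {x \<in> space D. right_prediction c x}"

definition vbar_R_above :: "(real ^ 'n) measure \<Rightarrow> 'n \<Rightarrow> real \<Rightarrow> real" where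
  "vbar_R_above D c \<beta> = cond_mean D (\<lambda>x. x $ c) (\<lambda>x. right_prediction c x \<and> x $ c > \<beta>)"

definition vbar_R_below :: "(real ^ 'n) measure \<Rightarrow> 'n \<Rightarrow> real \<Rightarrow> real" where
  "vbar_R_below D c \<beta> = cond_mean D (\<lambda>x. x $ c) (\<lambda>x. right_prediction c x \<and> x $ c < \<beta>)"

definition vbar_W_above :: "(real ^ 'n) measure \<Rightarrow> 'n \<Rightarrow> real \<Rightarrow> real" where
  "vbar_W_above D c \<beta> = cond_mean D (\<lambda>x. x $ c) (\<lambda>x. \<not> right_prediction c x \<and> vmax x > \<beta>)"

definition vbar_W_below :: "(real ^ 'n) measure \<Rightarrow> 'n \<Rightarrow> real \<Rightarrow> real" where
  "vbar_W_below D c \<beta> = cond_mean D (\<lambda>x. x $ c) (\<lambda>x. \<not> right_prediction c x \<and> vmax x < \<beta>)"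

definition F_R :: "(real ^ 'n) measure \<Rightarrow> 'n \<Rightarrow> real \<Rightarrow> real" where
  "F_R D c \<beta> = cond_prob D (\<lambda>x. x $ c \<le> \<beta>) (right_prediction c)"

definition F_W :: "(real ^ 'n) measure \<Rightarrow> 'n \<Rightarrow> real \<Rightarrow> real" where
  "F_W D c \<beta> = cond_prob D (\<lambda>x. vmax x \<le> \<beta>) (\<lambda>x. \<not> right_prediction c x)"

end

theory Submission
  imports Defs
begin

text \<open>
  Hoeffding's inequality and the Borel--Cantelli lemma give a strong law of large numbers for
  bounded variables, so almost surely both averages converge to the coordinatewise expectations
  under \<open>D\<close>. For the mass of class \<open>c\<close>, error correction changes \<open>x $ c\<close> by \<open>1 - x $ c\<close> on right
  instances above \<open>\<beta>\<^sub>2\<close>, by at least \<open>- x $ c\<close> on wrong ones above \<open>\<beta>\<^sub>2\<close>, and by \<open>1 / C - x $ c\<close> below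
  \<open>\<beta>\<^sub>1\<close>; the hypothesis says that the expectation of this lower bound is positive. Continuity of the
  conditional distribution functions removes the atoms at the thresholds, except for a right instance
  with \<open>x $ c = \<beta>\<^sub>2\<close>, where the correction can only help. The claim on the other classes follows
  because both limits have total mass \<open>1\<close>.
\<close>

section \<open>A strong law of large numbers for bounded variables\<close>

lemma (in prob_space) strong_law_bounded_iid:
  fixes X :: "nat \<Rightarrow> 'a \<Rightarrow> real"
  assumes indep: "indep_vars (\<lambda>_. borel) X UNIV"
    and distr: "\<And>k. distr M borel (X k) = distr M borel (X 0)"
    and bounded: "AE x in M. X 0 x \<in> {a..b}"
    and "a < b"
  shows "AE x in M. (\<lambda>n. (\<Sum>k<n. X k x) / real n) \<longlonglongrightarrow> expectation (X 0)"
proof -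
  define \<mu> where "\<mu> = expectation (X 0)"
  have X [measurable]: "X k \<in> borel_measurable M" for k
    using indep by (auto simp: indep_vars_def)
  have deviation: "AE x in M. \<forall>\<^sub>F n in sequentially. \<bar>(\<Sum>k<n. X k x) / real n - \<mu>\<bar> < \<epsilon>"
    if "\<epsilon> > 0" for \<epsilon> :: real
  proof -
    define A where "A n = {x \<in> space M. \<bar>(\<Sum>k<n. X k x) / real n - \<mu>\<bar> \<ge> \<epsilon>}" for n
    \<comment> \<open>The factor that one more sample contributes to Hoeffding's bound: the bound
      for \<open>n\<close> samples is \<open>2 * q ^ n\<close> with \<open>q < 1\<close>, hence
      summable. It is used from \<open>n = 1\<close> on, where the index set \<open>{..<n}\<close>
      is nonempty.\<close>
    define q where "q = exp (- 2 * \<epsilon>\<^sup>2 / (b - a)\<^sup>2)"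
    have A [measurable]: "A n \<in> sets M" for n
      unfolding A_def by measurable
    have "prob (A n) \<le> 2 * q ^ n" if "n \<ge> 1" for n
    proof -
      interpret iid_interval_bounded_random_variables M "{..<n}" X "X 0" a b
      proof
        show "indep_vars (\<lambda>_. borel) X {..<n}"
          using indep by (rule indep_vars_subset) auto
        show "distr M borel (X i) = distr M borel (X 0)" for i
          by (rule distr)
      qed (use bounded in auto)
      interpret Hoeffding_ineq_iid M "{..<n}" X "X 0" a b \<mu>
        by unfold_locales (simp add: \<mu>_def)
      have "prob (A n) \<le> 2 * exp (- 2 * real n * \<epsilon>\<^sup>2 / (b - a)\<^sup>2)"
        using Hoeffding_ineq_abs_ge'[of \<epsilon>] that \<open>\<epsilon> > 0\<close> \<open>a < b\<close> by (auto simp: A_def lessThan_empty_iff)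
      also have "exp (- 2 * real n * \<epsilon>\<^sup>2 / (b - a)\<^sup>2) = q ^ n"
        by (simp add: q_def exp_of_nat_mult [symmetric] mult_ac)
      finally show ?thesis .
    qed
    moreover have "summable (\<lambda>n. 2 * q ^ n)"
      using \<open>\<epsilon> > 0\<close> \<open>a < b\<close>
      by (intro summable_mult summable_geometric) (simp add: q_def)
    ultimately have "summable (\<lambda>n. prob (A n))"
      using summable_comparison_test'[of "\<lambda>n. 2 * q ^ n" 1 "\<lambda>n. prob (A n)"] by simp
    then have "AE x in M. \<forall>\<^sub>F n in sequentially. x \<in> space M - A n"
      by (intro borel_cantelli_AE1) (auto simp: emeasure_eq_measure)
    then show ?thesis
      by eventually_elim (auto elim!: eventually_mono simp: A_def)
  qed
  \<comment> \<open>The exceptional null set in \<open>deviation\<close> depends on \<epsilon>;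
    restricting to the countably many tolerances \<open>1 / Suc m\<close> gives a single null
    set.\<close>
  have "AE x in M. \<forall>m::nat. \<forall>\<^sub>F n in sequentially. \<bar>(\<Sum>k<n. X k x) / real n - \<mu>\<bar> < 1 / Suc m"
    by (subst AE_all_countable) (intro allI deviation, simp)
  then have "AE x in M. (\<lambda>n. (\<Sum>k<n. X k x) / real n) \<longlonglongrightarrow> \<mu>"
  proof eventually_elim
    case (elim x)
    show ?case
    proof (rule tendstoI)
      fix \<epsilon> :: real assume "\<epsilon> > 0"
      then obtain m where m: "1 / Suc m < \<epsilon>"
        using nat_approx_posE by blast
      from elim have "\<forall>\<^sub>F n in sequentially. \<bar>(\<Sum>k<n. X k x) / real n - \<mu>\<bar> < 1 / Suc m" ..
      then show "\<forall>\<^sub>F n in sequentially. dist ((\<Sum>k<n. X k x) / real n) \<mu> < \<epsilon>"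
        by eventually_elim (use m in \<open>simp add: dist_real_def\<close>)
    qed
  qed
  then show ?thesis
    by (simp add: \<mu>_def)
qed

section \<open>Conditional probabilities and conditional means\<close>

text \<open>Clears the denominator. If \<open>Q\<close> is null, both sides are 0, so
  \<open>alpha D c\<close> equal to 0 or 1 is covered as well.\<close>

lemma (in prob_space) cond_prob_mult_prob:
  "prob {x \<in> space M. Q x} * cond_prob M P Q = prob {x \<in> space M. P x \<and> Q x}"
  if [measurable]: "Measurable.pred M P" "Measurable.pred M Q"
proof (cases "prob {x \<in> space M. Q x} = 0")
  case True
  have "prob {x \<in> space M. P x \<and> Q x} \<le> prob {x \<in> space M. Q x}"
    by (intro finite_measure_mono) auto
  with True show ?thesis
    by (simp add: measure_le_0_iff)
qed (simp add: cond_prob_def)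

text \<open>An atom of \<open>f\<close> at \<beta> inside \<open>Q\<close> would be a jump of the
  distribution function: everywhere to the left of \<beta> its value falls short of the value at
  \<beta> by at least the mass of the atom.\<close>

lemma (in prob_space) prob_eq_0_of_isCont_cond_prob:
  fixes f :: "'a \<Rightarrow> real"
  assumes [measurable]: "f \<in> borel_measurable M" "Measurable.pred M Q"
    and cont: "isCont (\<lambda>b. cond_prob M (\<lambda>x. f x \<le> b) Q) \<beta>"
  shows "prob {x \<in> space M. f x = \<beta> \<and> Q x} = 0"
proof -
  let ?q = "prob {x \<in> space M. Q x}"
  let ?p = "prob {x \<in> space M. f x = \<beta> \<and> Q x}"
  let ?b = "\<lambda>n. \<beta> - 1 / real (Suc n)"
  \<comment> \<open>Scaling by \<open>?q\<close> turns the conditional distribution function into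
    the probability of a joint event, to which additivity applies.\<close>
  let ?G = "\<lambda>b. ?q * cond_prob M (\<lambda>x. f x \<le> b) Q"
  have "?b \<longlonglongrightarrow> \<beta> - 0"
    by (intro tendsto_diff tendsto_const LIMSEQ_Suc[OF lim_1_over_n])
  then have "?b \<longlonglongrightarrow> \<beta>"
    by simp
  then have "(\<lambda>n. ?G (?b n)) \<longlonglongrightarrow> ?G \<beta>"
    by (intro tendsto_mult tendsto_const isCont_tendsto_compose[OF cont])
  moreover have "?G (?b n) \<le> ?G \<beta> - ?p" for n
  proof -
    have "prob {x \<in> space M. f x \<le> ?b n \<and> Q x} + ?p =
          prob ({x \<in> space M. f x \<le> ?b n \<and> Q x} \<union> {x \<in> space M. f x = \<beta> \<and> Q x})"
      by (intro finite_measure_Union [symmetric]) auto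
    also have "\<dots> \<le> prob {x \<in> space M. f x \<le> \<beta> \<and> Q x}"
      by (intro finite_measure_mono) (auto intro: order_trans[of _ "?b n"])
    finally show ?thesis
      by (simp add: cond_prob_mult_prob)
  qed
  ultimately have "?G \<beta> \<le> ?G \<beta> - ?p"
    by (intro LIMSEQ_le_const2) auto
  then show ?thesis
    by (simp add: measure_le_0_iff)
qed

text \<open>On a null event the integral vanishes too, in agreement with the default value 0 of the
  conditional mean.\<close>

lemma (in prob_space) cond_mean_mult_prob:
  assumes [measurable]: "Measurable.pred M P"
  shows "cond_mean M f P * prob {x \<in> space M. P x} = (LINT x:{x \<in> space M. P x}|M. f x)"
proof (cases "prob {x \<in> space M. P x} = 0")
  case True
  then have "AE x in M. \<not> P x"
    by (subst (asm) prob_eq_0) auto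
  then have "(LINT x:{x \<in> space M. P x}|M. f x) = 0"
    unfolding set_lebesgue_integral_def
    by (intro integral_eq_zero_AE) (auto elim!: eventually_mono simp: indicator_def)
  with True show ?thesis by simp
qed (simp add: cond_mean_def)

section \<open>Measurability and pointwise properties of error correction\<close>

lemma measurable_vmax [measurable]: "vmax \<in> borel_measurable borel"
  unfolding vmax_def [abs_def] by measurable

lemma measurable_right_prediction [measurable]: "Measurable.pred borel (right_prediction c)"
  unfolding right_prediction_def [abs_def] by measurable

text \<open>The selected index depends on \<open>x\<close> only through its set of maximisers. There
  are finitely many such sets, and each is described by finitely many comparisons of
  coordinates.\<close>

lemma measurable_arg_max_eq [measurable]:
  "Measurable.pred borel (\<lambda>x :: real ^ 'n. (ARG_MAX (\<lambda>i. x $ i) i. True) = i)"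
proof -
  define h :: "'n set \<Rightarrow> 'n" where "h T = (SOME i. i \<in> T)" for T
  have "(ARG_MAX (\<lambda>i. x $ i) i. True) = h {i. \<forall>j. x $ j \<le> x $ i}" for x :: "real ^ 'n"
    by (simp add: arg_max_def is_arg_max_def h_def not_less)
  then have "(\<lambda>x :: real ^ 'n. (ARG_MAX (\<lambda>i. x $ i) i. True) = i) =
      (\<lambda>x. \<exists>T. h T = i \<and> T = {k. \<forall>j. x $ j \<le> x $ k})"
    by simp
  moreover have "Measurable.pred borel
      (\<lambda>x :: real ^ 'n. \<exists>T. h T = i \<and> T = {k. \<forall>j. x $ j \<le> x $ k})"
    unfolding set_eq_iff mem_Collect_eq by measurable
  ultimately show ?thesis by simp
qed

lemma measurable_error_correct_nth [measurable]:
  "(\<lambda>x :: real ^ 'n. error_correct \<beta>\<^sub>1 \<beta>\<^sub>2 x $ i) \<in> borel_measurable borel"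
proof -
  have "(\<lambda>x :: real ^ 'n. error_correct \<beta>\<^sub>1 \<beta>\<^sub>2 x $ i) =
    (\<lambda>x. if vmax x \<ge> \<beta>\<^sub>2 then (if (ARG_MAX (\<lambda>i. x $ i) i. True) = i then 1 else 0)
         else if vmax x \<ge> \<beta>\<^sub>1 then x $ i else 1 / real CARD('n))"
    by (auto simp: error_correct_def axis_def fun_eq_iff)
  then show ?thesis by simp
qed

lemma prob_vector_error_correct:
  assumes "prob_vector x"
  shows "prob_vector (error_correct \<beta>\<^sub>1 \<beta>\<^sub>2 x)"
  using assms by (auto simp: prob_vector_def error_correct_def axis_def)

lemma prob_vector_nth_bounds:
  assumes "prob_vector x"
  shows "0 \<le> x $ i" "x $ i \<le> 1"
  using assms member_le_sum[of i UNIV "\<lambda>i. x $ i"] by (auto simp: prob_vector_def)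

lemma pred_prob_vector [measurable]: "Measurable.pred borel prob_vector"
  unfolding prob_vector_def [abs_def] by measurable

lemma vmax_right_prediction:
  assumes "right_prediction c x"
  shows "vmax x = x $ c"
proof -
  have "x $ i \<le> x $ c" for i
    using assms by (cases "i = c") (auto simp: right_prediction_def less_imp_le)
  then show ?thesis
    unfolding vmax_def by (intro Max_eqI) auto
qed

text \<open>Strictness makes \<open>c\<close> the only maximiser, so the arbitrary selection among
  ties has no influence on right instances.\<close>

lemma arg_max_right_prediction:
  assumes "right_prediction c x"
  shows "(ARG_MAX (\<lambda>i. x $ i) i. True) = c"
  unfolding arg_max_def
proof (rule some_equality)
  show "is_arg_max (($) x) (\<lambda>i. True) c"
    using assms unfolding is_arg_max_def right_prediction_def by (metis less_asym)
  show "i = c" if "is_arg_max (($) x) (\<lambda>i. True) i" for i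
    using assms that unfolding is_arg_max_def right_prediction_def by auto
qed

section \<open>The expected gain in the mass of the correct class\<close>

text \<open>After the products are expanded, the difference of the two sides of \<open>gain\<close>
  is the integral of a function \<open>g\<close> that almost everywhere bounds the change made by
  error correction from below.\<close>

lemma expectation_error_correct_gt:
  fixes D :: "(real ^ 'n) measure"
  assumes "prob_space D" and sets_D [measurable_cong]: "sets D = sets borel"
    and pv: "AE x in D. prob_vector x"
    and "\<beta>\<^sub>1 < \<beta>\<^sub>2"
    and cont: "isCont (F_R D c) \<beta>\<^sub>1" "isCont (F_W D c) \<beta>\<^sub>1" "isCont (F_W D c) \<beta>\<^sub>2"
    and gain: "alpha D c *
           ((1 - vbar_R_above D c \<beta>\<^sub>2) * (1 - F_R D c \<beta>\<^sub>2)
            - (vbar_R_below D c \<beta>\<^sub>1 - 1 / real CARD('n)) * F_R D c \<beta>\<^sub>1)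
         > (1 - alpha D c) *
           (vbar_W_above D c \<beta>\<^sub>2 * (1 - F_W D c \<beta>\<^sub>2)
            - (1 / real CARD('n) - vbar_W_below D c \<beta>\<^sub>1) * F_W D c \<beta>\<^sub>1)"
  shows "(LINT x|D. x $ c) < (LINT x|D. error_correct \<beta>\<^sub>1 \<beta>\<^sub>2 x $ c)"
proof -
  interpret prob_space D by fact
  let ?C = "real CARD('n)"
  let ?R = "right_prediction c"
  \<comment> \<open>The inequalities are strict in all four events, as in the events that the
    conditional means are conditioned on.\<close>
  define A where "A = {x \<in> space D. ?R x \<and> x $ c > \<beta>\<^sub>2}"
  define B where "B = {x \<in> space D. ?R x \<and> x $ c < \<beta>\<^sub>1}"
  define E where "E = {x \<in> space D. \<not> ?R x \<and> vmax x > \<beta>\<^sub>2}"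
  define F where "F = {x \<in> space D. \<not> ?R x \<and> vmax x < \<beta>\<^sub>1}"
  define I where "I S = (LINT x:S|D. x $ c)" for S
  have [measurable]: "A \<in> sets D" "B \<in> sets D" "E \<in> sets D" "F \<in> sets D"
    unfolding A_def B_def E_def F_def by measurable

  have compl: "prob {x \<in> space D. \<not> ?R x} = 1 - alpha D c"
    unfolding alpha_def by (intro prob_neg) measurable
  have F_R: "alpha D c * F_R D c \<beta> = prob {x \<in> space D. x $ c \<le> \<beta> \<and> ?R x}" for \<beta>
    unfolding alpha_def F_R_def by (intro cond_prob_mult_prob) measurable
  have F_W: "(1 - alpha D c) * F_W D c \<beta> = prob {x \<in> space D. vmax x \<le> \<beta> \<and> \<not> ?R x}" for \<beta>
    unfolding compl [symmetric] F_W_def by (intro cond_prob_mult_prob) measurable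
  \<comment> \<open>The distribution functions count values \<open>\<le> \<beta>\<^sub>1\<close>,
    while the means condition on values \<open>< \<beta>\<^sub>1\<close>; \<open>R1\<close> and
    \<open>W1\<close> reconcile the two. At \<open>\<beta>\<^sub>2\<close> the complement of
    \<open>\<le>\<close> is already the strict event, and \<open>W2\<close> serves the pointwise
    comparison with \<open>g\<close> instead.\<close>
  have R1: "prob {x \<in> space D. x $ c = \<beta>\<^sub>1 \<and> ?R x} = 0"
    using cont(1) unfolding F_R_def by (intro prob_eq_0_of_isCont_cond_prob) auto
  have W1: "prob {x \<in> space D. vmax x = \<beta>\<^sub>1 \<and> \<not> ?R x} = 0"
    using cont(2) unfolding F_W_def by (intro prob_eq_0_of_isCont_cond_prob) auto
  have W2: "prob {x \<in> space D. vmax x = \<beta>\<^sub>2 \<and> \<not> ?R x} = 0"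
    using cont(3) unfolding F_W_def by (intro prob_eq_0_of_isCont_cond_prob) auto

  have A: "alpha D c * (1 - F_R D c \<beta>\<^sub>2) = prob A"
  proof -
    have "alpha D c = prob (A \<union> {x \<in> space D. x $ c \<le> \<beta>\<^sub>2 \<and> ?R x})"
      unfolding alpha_def A_def by (intro arg_cong[where f = prob]) auto
    also have "\<dots> = prob A + prob {x \<in> space D. x $ c \<le> \<beta>\<^sub>2 \<and> ?R x}"
      by (intro finite_measure_Union) (auto simp: A_def)
    finally show ?thesis
      using F_R[of \<beta>\<^sub>2] by (simp add: right_diff_distrib)
  qed
  have B: "alpha D c * F_R D c \<beta>\<^sub>1 = prob B"
  proof -
    have "prob {x \<in> space D. x $ c \<le> \<beta>\<^sub>1 \<and> ?R x} =
          prob (B \<union> {x \<in> space D. x $ c = \<beta>\<^sub>1 \<and> ?R x})"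
      unfolding B_def by (intro arg_cong[where f = prob]) auto
    also have "\<dots> = prob B + prob {x \<in> space D. x $ c = \<beta>\<^sub>1 \<and> ?R x}"
      by (intro finite_measure_Union) (auto simp: B_def)
    finally show ?thesis
      by (simp add: F_R R1)
  qed
  have E: "(1 - alpha D c) * (1 - F_W D c \<beta>\<^sub>2) = prob E"
  proof -
    have "1 - alpha D c = prob (E \<union> {x \<in> space D. vmax x \<le> \<beta>\<^sub>2 \<and> \<not> ?R x})"
      unfolding compl [symmetric] E_def by (intro arg_cong[where f = prob]) auto
    also have "\<dots> = prob E + prob {x \<in> space D. vmax x \<le> \<beta>\<^sub>2 \<and> \<not> ?R x}"
      by (intro finite_measure_Union) (auto simp: E_def)
    finally show ?thesis
      using F_W[of \<beta>\<^sub>2] by (simp add: right_diff_distrib)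
  qed
  have F: "(1 - alpha D c) * F_W D c \<beta>\<^sub>1 = prob F"
  proof -
    have "prob {x \<in> space D. vmax x \<le> \<beta>\<^sub>1 \<and> \<not> ?R x} =
          prob (F \<union> {x \<in> space D. vmax x = \<beta>\<^sub>1 \<and> \<not> ?R x})"
      unfolding F_def by (intro arg_cong[where f = prob]) auto
    also have "\<dots> = prob F + prob {x \<in> space D. vmax x = \<beta>\<^sub>1 \<and> \<not> ?R x}"
      by (intro finite_measure_Union) (auto simp: F_def)
    finally show ?thesis
      by (simp add: F_W W1)
  qed

  have I: "vbar_R_above D c \<beta>\<^sub>2 * prob A = I A" "vbar_R_below D c \<beta>\<^sub>1 * prob B = I B"
    "vbar_W_above D c \<beta>\<^sub>2 * prob E = I E" "vbar_W_below D c \<beta>\<^sub>1 * prob F = I F"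
    unfolding vbar_R_above_def vbar_R_below_def vbar_W_above_def vbar_W_below_def
      A_def B_def E_def F_def I_def
    by (rule cond_mean_mult_prob; measurable)+
  have "0 < alpha D c *
           ((1 - vbar_R_above D c \<beta>\<^sub>2) * (1 - F_R D c \<beta>\<^sub>2)
            - (vbar_R_below D c \<beta>\<^sub>1 - 1 / ?C) * F_R D c \<beta>\<^sub>1)
         - (1 - alpha D c) *
           (vbar_W_above D c \<beta>\<^sub>2 * (1 - F_W D c \<beta>\<^sub>2)
            - (1 / ?C - vbar_W_below D c \<beta>\<^sub>1) * F_W D c \<beta>\<^sub>1)"
    using gain by simp
  \<comment> \<open>Regrouped so that each weight \<alpha> or 1 - \<alpha> stands next to its
    distribution function; by \<open>A\<close>, \<open>B\<close>, \<open>E\<close> and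
    \<open>F\<close> these products are the probabilities of the four events.\<close>
  also have "\<dots> = (1 - vbar_R_above D c \<beta>\<^sub>2) * (alpha D c * (1 - F_R D c \<beta>\<^sub>2))
            - (vbar_R_below D c \<beta>\<^sub>1 - 1 / ?C) * (alpha D c * F_R D c \<beta>\<^sub>1)
            - vbar_W_above D c \<beta>\<^sub>2 * ((1 - alpha D c) * (1 - F_W D c \<beta>\<^sub>2))
            + (1 / ?C - vbar_W_below D c \<beta>\<^sub>1) * ((1 - alpha D c) * F_W D c \<beta>\<^sub>1)"
    by algebra
  also have "\<dots> = (prob A - I A) + (prob B / ?C - I B) - I E + (prob F / ?C - I F)"
    unfolding A B E F I [symmetric] by (simp add: algebra_simps)
  finally have pos: "0 < (prob A - I A) + (prob B / ?C - I B) - I E + (prob F / ?C - I F)" .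

  have int [simp]: "integrable D (\<lambda>x. x $ c)"
    using pv by (intro integrable_const_bound[of _ 1])
      (auto elim!: eventually_mono simp: prob_vector_nth_bounds)
  have int_S [simp]: "integrable D (\<lambda>x. indicator S x * x $ c)" if "S \<in> sets D" for S
    using integrable_mult_indicator[OF that int] by simp
  have int_ec [simp]: "integrable D (\<lambda>x. error_correct \<beta>\<^sub>1 \<beta>\<^sub>2 x $ c)"
    using pv by (intro integrable_const_bound[of _ 1])
      (auto elim!: eventually_mono simp: prob_vector_nth_bounds prob_vector_error_correct)
  \<comment> \<open>On \<open>E\<close> the corrected mass of class \<open>c\<close> is replaced by
    its lower bound 0; on \<open>A\<close>, \<open>B\<close> and \<open>F\<close> the change is
    recorded exactly, and elsewhere \<open>g\<close> is 0.\<close>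
  define g where "g x = (indicator A x - indicator A x * x $ c)
      + (indicator B x / ?C - indicator B x * x $ c) - indicator E x * x $ c
      + (indicator F x / ?C - indicator F x * x $ c)" for x
  have int_g: "integrable D g"
    unfolding g_def by (intro Bochner_Integration.integrable_add Bochner_Integration.integrable_diff)
      (auto simp: integrable_real_indicator less_top[symmetric])
  have "(LINT x|D. g x) = (prob A - I A) + (prob B / ?C - I B) - I E + (prob F / ?C - I F)"
    unfolding g_def I_def set_lebesgue_integral_def
    by (simp add: less_top[symmetric])
  with pos have "0 < (LINT x|D. g x)" by simp

  \<comment> \<open>Error correction already rounds when \<open>vmax x = \<beta>\<^sub>2\<close>,
    where \<open>g\<close> is 0. A wrong instance there could lose \<open>x $ c\<close>, hence the
    exclusion; a right one gains \<open>1 - x $ c\<close>, which is nonnegative.\<close>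
  also have "AE x in D. \<not> (vmax x = \<beta>\<^sub>2 \<and> \<not> ?R x)"
    using W2 by (subst (asm) prob_eq_0) auto
  then have "AE x in D. g x \<le> error_correct \<beta>\<^sub>1 \<beta>\<^sub>2 x $ c - x $ c"
    using pv AE_space
  proof eventually_elim
    case (elim x)
    note bounds = prob_vector_nth_bounds[OF elim(2), of c]
    show ?case
    proof (cases "?R x")
      case True
      with elim bounds \<open>\<beta>\<^sub>1 < \<beta>\<^sub>2\<close> show ?thesis
        by (auto simp: g_def A_def B_def E_def F_def error_correct_def vmax_right_prediction
            arg_max_right_prediction indicator_def)
    next
      \<comment> \<open>A tied maximum counts as wrong, yet \<open>ARG_MAX\<close> may still select
        \<open>c\<close>. The corrected mass is then 1 rather than 0, and the bound
        \<open>- x $ c\<close> remains valid.\<close>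
      case False
      with elim bounds \<open>\<beta>\<^sub>1 < \<beta>\<^sub>2\<close> show ?thesis
        by (auto simp: g_def A_def B_def E_def F_def error_correct_def axis_def indicator_def)
    qed
  qed
  then have "(LINT x|D. g x) \<le> (LINT x|D. error_correct \<beta>\<^sub>1 \<beta>\<^sub>2 x $ c - x $ c)"
    by (intro integral_mono_AE int_g Bochner_Integration.integrable_diff) simp_all
  finally show ?thesis by simp
qed

section \<open>Almost sure limits of the two ensemble averages\<close>

text \<open>The scalar law applies to each coordinate, which lies in [0, 1], and finitely many null
  sets are joined. The map \<open>f\<close> is the identity for Algorithm 1 and error correction for
  Algorithm 2.\<close>

lemma (in prob_space) strong_law_prob_vector:
  fixes v :: "nat \<Rightarrow> 'a \<Rightarrow> real ^ 'n"
  assumes indep: "indep_vars (\<lambda>_. borel) v UNIV"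
    and distr: "\<And>k. distr M borel (v k) = D"
    and pv: "\<And>k \<omega>. \<omega> \<in> space M \<Longrightarrow> prob_vector (v k \<omega>)"
    and f [measurable]: "\<And>i. (\<lambda>x. f x $ i) \<in> borel_measurable borel"
    and f_pv: "\<And>x. prob_vector x \<Longrightarrow> prob_vector (f x)"
  shows "AE \<omega> in M. (\<lambda>K. (1 / real K) *\<^sub>R (\<Sum>k<K. f (v k \<omega>))) \<longlonglongrightarrow> (\<chi> i. LINT x|D. f x $ i)"
proof -
  have v [measurable]: "v k \<in> borel_measurable M" for k
    using indep by (auto simp: indep_vars_def)
  have "AE \<omega> in M. (\<lambda>K. (\<Sum>k<K. f (v k \<omega>) $ i) / real K) \<longlonglongrightarrow> (LINT x|D. f x $ i)" for i
  proof -
    have distr_f: "distr M borel (\<lambda>\<omega>. f (v k \<omega>) $ i) = distr D borel (\<lambda>x. f x $ i)" for k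
      unfolding distr[of k, symmetric] by (subst distr_distr) (auto simp: o_def)
    have "AE \<omega> in M. (\<lambda>K. (\<Sum>k<K. f (v k \<omega>) $ i) / real K)
        \<longlonglongrightarrow> expectation (\<lambda>\<omega>. f (v 0 \<omega>) $ i)"
    proof (rule strong_law_bounded_iid[of _ 0 1])
      show "indep_vars (\<lambda>_. borel) (\<lambda>k \<omega>. f (v k \<omega>) $ i) UNIV"
        by (rule indep_vars_compose2[OF indep]) simp
      show "AE \<omega> in M. f (v 0 \<omega>) $ i \<in> {0..1}"
        using pv f_pv by (auto simp: prob_vector_nth_bounds)
    qed (simp_all add: distr_f)
    also have "expectation (\<lambda>\<omega>. f (v 0 \<omega>) $ i) = (LINT x|D. f x $ i)"
      unfolding distr[of 0, symmetric] by (simp add: integral_distr)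
    finally show ?thesis .
  qed
  then have "AE \<omega> in M. \<forall>i. (\<lambda>K. (\<Sum>k<K. f (v k \<omega>) $ i) / real K) \<longlonglongrightarrow> (LINT x|D. f x $ i)"
    by (subst AE_all_countable) simp
  then show ?thesis
    by eventually_elim (intro vec_tendstoI, simp)
qed

lemma (in prob_space) sum_expectation_prob_vector:
  assumes [measurable]: "\<And>i. (\<lambda>x. f x $ i) \<in> borel_measurable M"
    and pv: "AE x in M. prob_vector (f x)"
  shows "(\<Sum>i\<in>UNIV. expectation (\<lambda>x. f x $ i)) = 1"
proof -
  have "integrable M (\<lambda>x. f x $ i)" for i
    using pv by (intro integrable_const_bound[of _ 1])
      (auto elim!: eventually_mono simp: prob_vector_nth_bounds)
  then have "(\<Sum>i\<in>UNIV. expectation (\<lambda>x. f x $ i)) = expectation (\<lambda>x. \<Sum>i\<in>UNIV. f x $ i)"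
    by simp
  also have "\<dots> = expectation (\<lambda>x. 1)"
    using pv by (intro integral_cong_AE) (auto simp: prob_vector_def)
  finally show ?thesis
    by (simp add: prob_space)
qed

section \<open>Comparison of the limiting distributions\<close>

text \<open>Convergence is part of the claim because it is what gives \<open>lim\<close> its
  meaning. Equality off \<open>c\<close> is assumed for Algorithm 2 only, and the argument controls
  the incorrect classes of Algorithm 1 through their total; hence the comparison with their average,
  and with each single class once these share one value.\<close>

theorem theorem3p1:
  fixes M :: "'a measure"
    and v :: "nat \<Rightarrow> 'a \<Rightarrow> real ^ 'n"
    and D :: "(real ^ 'n) measure"
    and c :: 'n
    and \<beta>\<^sub>1 \<beta>\<^sub>2 :: real
  assumes "prob_space M"
    and "prob_space.indep_vars M (\<lambda>_. borel) v UNIV"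
    and "\<And>k. distr M borel (v k) = D"
    and "\<And>k \<omega>. \<omega> \<in> space M \<Longrightarrow> prob_vector (v k \<omega>)"
    and "\<beta>\<^sub>1 < \<beta>\<^sub>2"
    and "isCont (F_R D c) \<beta>\<^sub>1" and "isCont (F_W D c) \<beta>\<^sub>1" and "isCont (F_W D c) \<beta>\<^sub>2"
    and "AE \<omega> in M. \<forall>i j. i \<noteq> c \<longrightarrow> j \<noteq> c \<longrightarrow>
           lim (algorithm2 \<beta>\<^sub>1 \<beta>\<^sub>2 (\<lambda>k. v k \<omega>)) $ i = lim (algorithm2 \<beta>\<^sub>1 \<beta>\<^sub>2 (\<lambda>k. v k \<omega>)) $ j"
    and "alpha D c *
           ((1 - vbar_R_above D c \<beta>\<^sub>2) * (1 - F_R D c \<beta>\<^sub>2)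
            - (vbar_R_below D c \<beta>\<^sub>1 - 1 / real CARD('n)) * F_R D c \<beta>\<^sub>1)
         > (1 - alpha D c) *
           (vbar_W_above D c \<beta>\<^sub>2 * (1 - F_W D c \<beta>\<^sub>2)
            - (1 / real CARD('n) - vbar_W_below D c \<beta>\<^sub>1) * F_W D c \<beta>\<^sub>1)"
  shows "AE \<omega> in M.
           convergent (algorithm1 (\<lambda>k. v k \<omega>)) \<and>
           convergent (algorithm2 \<beta>\<^sub>1 \<beta>\<^sub>2 (\<lambda>k. v k \<omega>)) \<and>
           (let s1 = lim (algorithm1 (\<lambda>k. v k \<omega>));
                s2 = lim (algorithm2 \<beta>\<^sub>1 \<beta>\<^sub>2 (\<lambda>k. v k \<omega>))
            in s2 $ c - s1 $ c > 0 \<and>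
               (\<forall>i. i \<noteq> c \<longrightarrow> s2 $ i < (\<Sum>j\<in>UNIV - {c}. s1 $ j) / real (CARD('n) - 1)) \<and>
               ((\<forall>i j. i \<noteq> c \<longrightarrow> j \<noteq> c \<longrightarrow> s1 $ i = s1 $ j) \<longrightarrow>
                (\<forall>i. i \<noteq> c \<longrightarrow> s2 $ i < s1 $ i)))"

proof -
  interpret prob_space M by fact
  have v [measurable]: "v k \<in> borel_measurable M" for k
    using assms(2) by (auto simp: indep_vars_def)
  have D: "D = distr M borel (v 0)"
    using assms(3) by simp
  have sets_D [measurable_cong]: "sets D = sets borel"
    by (simp add: D)
  interpret D: prob_space D
    unfolding D by (rule prob_space_distr) simp
  have pv: "AE x in D. prob_vector x"
    unfolding D using assms(4) by (subst AE_distr_iff) auto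
  define s1 where "s1 = (\<chi> i. LINT x|D. x $ i)"
  define s2 where "s2 = (\<chi> i. LINT x|D. error_correct \<beta>\<^sub>1 \<beta>\<^sub>2 x $ i)"
  have alg1: "AE \<omega> in M. algorithm1 (\<lambda>k. v k \<omega>) \<longlonglongrightarrow> s1"
    unfolding algorithm1_def [abs_def] s1_def
    by (rule strong_law_prob_vector[where f = "\<lambda>x. x", OF assms(2-4)]) auto
  have alg2: "AE \<omega> in M. algorithm2 \<beta>\<^sub>1 \<beta>\<^sub>2 (\<lambda>k. v k \<omega>) \<longlonglongrightarrow> s2"
    unfolding algorithm2_def [abs_def] s2_def
    by (rule strong_law_prob_vector[OF assms(2-4)]) (auto intro: prob_vector_error_correct)
  have gt: "s1 $ c < s2 $ c"
    using expectation_error_correct_gt[OF D.prob_space_axioms sets_D pv assms(5-8,10)]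
    by (simp add: s1_def s2_def)
  have "(\<Sum>i\<in>UNIV. s1 $ i) = 1"
    using D.sum_expectation_prob_vector[of "\<lambda>x. x"] pv by (simp add: s1_def)
  then have sum1: "(\<Sum>i\<in>UNIV - {c}. s1 $ i) = 1 - s1 $ c"
    by (simp add: sum_diff1)
  have "AE x in D. prob_vector (error_correct \<beta>\<^sub>1 \<beta>\<^sub>2 x)"
    using pv by eventually_elim (rule prob_vector_error_correct)
  then have "(\<Sum>i\<in>UNIV. s2 $ i) = 1"
    using D.sum_expectation_prob_vector[of "error_correct \<beta>\<^sub>1 \<beta>\<^sub>2"] by (simp add: s2_def)
  then have sum2: "(\<Sum>i\<in>UNIV - {c}. s2 $ i) = 1 - s2 $ c"
    by (simp add: sum_diff1)
  have sum_others: "(\<Sum>j\<in>UNIV - {c}. s $ j) = real (CARD('n) - 1) * s $ i"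
    if "\<forall>i j. i \<noteq> c \<longrightarrow> j \<noteq> c \<longrightarrow> s $ i = s $ j" "i \<noteq> c" for s :: "real ^ 'n" and i
  proof -
    have "(\<Sum>j\<in>UNIV - {c}. s $ j) = (\<Sum>j\<in>UNIV - {c}. s $ i)"
      by (rule sum.cong) (use that in blast)+
    then show ?thesis
      by (simp add: card_Diff_singleton)
  qed
  \<comment> \<open>An incorrect class exists only if there are at least two classes, so the divisor
    in the average is positive.\<close>
  have card_pos: "real (CARD('n) - 1) > 0" if "i \<noteq> c" for i
  proof -
    have "card {i, c} \<le> CARD('n)"
      by (intro card_mono) auto
    with that show ?thesis by simp
  qed
  show ?thesis
    using alg1 alg2 assms(9)
  proof eventually_elim
    case (elim \<omega>)
    have lims: "lim (algorithm1 (\<lambda>k. v k \<omega>)) = s1" "lim (algorithm2 \<beta>\<^sub>1 \<beta>\<^sub>2 (\<lambda>k. v k \<omega>)) = s2"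
      using elim by (auto intro: limI)
    have others: "s2 $ i < (\<Sum>j\<in>UNIV - {c}. s1 $ j) / real (CARD('n) - 1)" if "i \<noteq> c" for i
    proof -
      \<comment> \<open>The incorrect classes share the mass \<open>1 - s2 $ c\<close> equally,
        which is less than the mass \<open>1 - s1 $ c\<close> left to them by Algorithm 1.\<close>
      have "s2 $ i * real (CARD('n) - 1) = 1 - s2 $ c"
        using sum_others[OF elim(3)[unfolded lims] that] unfolding sum2 by (simp only: mult.commute)
      also have "\<dots> < (\<Sum>j\<in>UNIV - {c}. s1 $ j)"
        using gt by (simp add: sum1)
      finally show ?thesis
        using card_pos[OF that] by (simp add: pos_less_divide_eq)
    qed
    moreover have "s2 $ i < s1 $ i"
      if "\<forall>i j. i \<noteq> c \<longrightarrow> j \<noteq> c \<longrightarrow> s1 $ i = s1 $ j" "i \<noteq> c" for i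
      using others[OF that(2)] card_pos[OF that(2)] unfolding sum_others[OF that] by simp
    ultimately show ?case
      using elim(1,2) gt unfolding lims Let_def convergent_def diff_gt_0_iff_gt by blast
  qed
qed

end
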